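(* Let $(X,d)$ be a finite metric space equipped with the uniform probability measure. Then the Laplace operator $\Delta$ on $X$, regarded as an $X\times X$-indexed matrix and hence as an element of $C(X\times X)$, belongs to the coherent algebra $\mathrm{Coh}(X)$.
   Context: **Laplacian.** Let $(X,d)$ be a finite metric space, $\mu$ the uniform probability measure ($\mu(\{x\})=1/|X|$), and $Z=\{(x,y)\in X^2\mid x\ne y\}$. Define $\partial:C(X)\to C(Z)$ by $\partial f(x,y)=f(x)-f(y)$. Put $c_{xy}=1/d(x,y)$ for $x\neq y$. Equip $C(Z)$ with the inner product $$\langle\omega,\omega'\rangle=\int_X\left(\sum_{x\ne y}\overline{\omega(x,y)}\,\omega'(x,y)\,c_{xy}\right)\mathrm{d}\mu(y)$$ (for each fixed $y$, the inner sum is over $x\in X$ with $x\neq y$), and $C(X)=L^2(X,\mu)$ with $\langle f,f'\rangle=\int_X\overline{f(x)}f'(x)\,\mathrm{d}\mu(x)$. The Laplacian is the unique positive operator $\Delta$ on $L^2(X)$ with $\langle\partial f,\partial f'\rangle=\langle f,\Delta f'\rangle$ for all $f,f'\in C(X)$. It is viewed as an $X\times X$-indexed matrix $(\Delta_{xy})$ acting on $L^2(X)\cong\mathbb{C}^{|X|}$ (standard basis of characteristic functions of points) by $(\Delta g)(x)=\sum_y\Delta_{xy}g(y)$, and so as the function $(x,y)\mapsto\Delta_{xy}$ on $X\times X$. **Coherent algebra.** For a compact metric space $(X,d)$ with a faithful probability measure $\mu$, convolution on $C(X\times X)$ is $$(f*g)(x,z)=\int_X f(x,y)g(y,z)\,\mathrm{d}\mu(y).$$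 The coherent algebra $\mathrm{Coh}(X)$ is the smallest unital $C^*$-subalgebra of $C(X\times X)$ (with respect to the standard pointwise algebra structure) that contains $d$, is closed under the convolution $*$, and is closed under flips: if $f\in\mathrm{Coh}(X)$ then so is $(x,y)\mapsto f(y,x)$. *)

theory Defs
  imports "HOL-Analysis.Analysis"
begin

section \<open>The Laplacian of a finite metric space\<close>

definition L2_inner :: "('a \<Rightarrow> complex) \<Rightarrow> ('a \<Rightarrow> complex) \<Rightarrow> complex" where
  "L2_inner f g = (LINT x|uniform_count_measure UNIV. cnj (f x) * g x)"

text \<open>
  With \<open>Z = {(x, y). x \<noteq> y}\<close>, an element of \<open>C(Z)\<close> is represented by a function on all pairs;
  its values on the diagonal are never used.
\<close>

definition C_Z_inner ::
    "('a::{metric_space,finite} \<times> 'a \<Rightarrow> complex) \<Rightarrow> ('a \<times> 'a \<Rightarrow> complex) \<Rightarrow> complex" where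
  "C_Z_inner \<omega> \<omega>' = (LINT y|uniform_count_measure UNIV.
      (\<Sum>x\<in>{x. x \<noteq> y}. cnj (\<omega> (x, y)) * \<omega>' (x, y) * complex_of_real (1 / dist x y)))"

definition partial_diff :: "('a \<Rightarrow> complex) \<Rightarrow> 'a \<times> 'a \<Rightarrow> complex" where
  "partial_diff f = (\<lambda>(x, y). f x - f y)"

definition complex_linear_op :: "(('a \<Rightarrow> complex) \<Rightarrow> ('a \<Rightarrow> complex)) \<Rightarrow> bool" where
  "complex_linear_op D \<longleftrightarrow>
     (\<forall>f g. D (\<lambda>x. f x + g x) = (\<lambda>x. D f x + D g x)) \<and>
     (\<forall>c f. D (\<lambda>x. c * f x) = (\<lambda>x. c * D f x))"

definition positive_op :: "(('a \<Rightarrow> complex) \<Rightarrow> ('a \<Rightarrow> complex)) \<Rightarrow> bool" where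
  "positive_op D \<longleftrightarrow> complex_linear_op D \<and> (\<forall>f. L2_inner f (D f) \<in> \<real>\<^sub>\<ge>\<^sub>0)"

definition is_laplacian ::
    "(('a::{metric_space,finite} \<Rightarrow> complex) \<Rightarrow> ('a \<Rightarrow> complex)) \<Rightarrow> bool" where
  "is_laplacian D \<longleftrightarrow> positive_op D \<and>
     (\<forall>f g. C_Z_inner (partial_diff f) (partial_diff g) = L2_inner f (D g))"

text \<open>Existence and uniqueness are shown in \<open>is_laplacian_ex1\<close> below.\<close>

definition laplacian :: "('a::{metric_space,finite} \<Rightarrow> complex) \<Rightarrow> ('a \<Rightarrow> complex)" where
  "laplacian = (THE D. is_laplacian D)"

text \<open>
  The matrix of an operator in the standard basis of characteristic functions of points,
  as a function of (row, column).
\<close>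

definition matrix_of_op ::
    "(('a \<Rightarrow> complex) \<Rightarrow> ('a \<Rightarrow> complex)) \<Rightarrow> 'a \<times> 'a \<Rightarrow> complex" where
  "matrix_of_op D = (\<lambda>(x, y). D (indicator {y}) x)"

lemma matrix_of_op_action:
  fixes D :: "('a::finite \<Rightarrow> complex) \<Rightarrow> ('a \<Rightarrow> complex)"
  assumes "complex_linear_op D"
  shows "D g x = (\<Sum>y\<in>UNIV. matrix_of_op D (x, y) * g y)"
proof -
  have add: "D (\<lambda>x. f x + h x) = (\<lambda>x. D f x + D h x)"
    and scale: "D (\<lambda>x. c * f x) = (\<lambda>x. c * D f x)" for f h c
    using assms by (auto simp: complex_linear_op_def)
  have zero: "D (\<lambda>_. 0) = (\<lambda>_. 0)"
    using scale[of 0 "\<lambda>_. 0"] by simp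
  have expand: "D (\<lambda>z. \<Sum>y\<in>A. g y * indicator {y} z) x = (\<Sum>y\<in>A. g y * D (indicator {y}) x)"
    if "finite A" for A
    using that
  proof induction
    case empty
    show ?case by (simp add: zero)
  next
    case (insert a A)
    show ?case
      unfolding sum.insert[OF insert.hyps] add scale insert.IH ..
  qed
  have basis: "(\<lambda>z. \<Sum>y\<in>UNIV. g y * indicator {y} z) = g"
    by (rule ext) (simp add: indicator_def)
  show ?thesis
    using expand[of UNIV, OF finite] unfolding basis
    by (simp only: matrix_of_op_def case_prod_conv mult.commute[of "D _ _"])
qed

lemma integral_uniform_finite:
  fixes h :: "'a::finite \<Rightarrow> complex"
  shows "(LINT x|uniform_count_measure UNIV. h x) = (\<Sum>x\<in>UNIV. h x) / of_nat CARD('a)"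
  by (simp add: uniform_count_measure_def lebesgue_integral_point_measure_finite
      scaleR_conv_of_real sum_divide_distrib)

lemma L2_inner_finite:
  fixes f g :: "'a::finite \<Rightarrow> complex"
  shows "L2_inner f g = (\<Sum>x\<in>UNIV. cnj (f x) * g x) / of_nat CARD('a)"
  by (simp add: L2_inner_def integral_uniform_finite)

lemma is_laplacian_ex1: "\<exists>!D :: ('a::{metric_space,finite} \<Rightarrow> complex) \<Rightarrow> _. is_laplacian D"
proof (rule ex_ex1I)
  define c :: "'a \<Rightarrow> 'a \<Rightarrow> complex" where "c x y = complex_of_real (1 / dist x y)" for x y
  have c_sym: "c x y = c y x" for x y
    by (simp add: c_def dist_commute)
  define D :: "('a \<Rightarrow> complex) \<Rightarrow> ('a \<Rightarrow> complex)"
    where "D f x = 2 * (\<Sum>y\<in>UNIV. c x y * (f x - f y))" for f x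
  have lin: "complex_linear_op D"
    unfolding complex_linear_op_def D_def
    by (auto simp: algebra_simps sum.distrib sum_subtractf sum_distrib_left fun_eq_iff)
  have inner: "C_Z_inner f g =
      (\<Sum>y\<in>UNIV. \<Sum>x\<in>UNIV. cnj (f (x, y)) * g (x, y) * c x y) / of_nat CARD('a)"
    for f g :: "'a \<times> 'a \<Rightarrow> complex"
  proof -
    have "(\<Sum>x\<in>{x. x \<noteq> y}. cnj (f (x, y)) * g (x, y) * complex_of_real (1 / dist x y)) =
        (\<Sum>x\<in>UNIV. cnj (f (x, y)) * g (x, y) * c x y)" for y
      unfolding c_def by (rule sum.mono_neutral_left) auto
    thus ?thesis
      by (simp only: C_Z_inner_def integral_uniform_finite)
  qed
  have green: "C_Z_inner (partial_diff f) (partial_diff g) = L2_inner f (D g)" for f g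
  proof -
    let ?S = "\<Sum>x\<in>UNIV. \<Sum>y\<in>UNIV. cnj (f x) * (g x - g y) * c x y"
    have "(\<Sum>y\<in>UNIV. \<Sum>x\<in>UNIV. cnj (f x - f y) * (g x - g y) * c x y) =
        (\<Sum>y\<in>UNIV. \<Sum>x\<in>UNIV. cnj (f x) * (g x - g y) * c x y) +
        (\<Sum>y\<in>UNIV. \<Sum>x\<in>UNIV. cnj (f y) * (g y - g x) * c x y)"
      by (simp add: algebra_simps flip: sum.distrib)
    also have "(\<Sum>y\<in>UNIV. \<Sum>x\<in>UNIV. cnj (f x) * (g x - g y) * c x y) = ?S"
      by (rule sum.swap)
    also have "(\<Sum>y\<in>UNIV. \<Sum>x\<in>UNIV. cnj (f y) * (g y - g x) * c x y) = ?S"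
      by (simp add: c_sym)
    also have "?S + ?S = (\<Sum>x\<in>UNIV. cnj (f x) * D g x)"
      by (simp add: D_def sum_distrib_left mult_ac flip: sum.distrib)
    finally show ?thesis
      by (simp add: inner L2_inner_finite partial_diff_def)
  qed
  have "L2_inner f (D f) \<in> \<real>\<^sub>\<ge>\<^sub>0" for f
  proof -
    have cmod: "cnj z * z * c x y = complex_of_real ((cmod z)\<^sup>2 / dist x y)" for x y z
      by (simp add: c_def mult.commute[of "cnj z"] flip: complex_norm_square)
    hence "L2_inner f (D f) = complex_of_real
        ((\<Sum>y\<in>UNIV. \<Sum>x\<in>UNIV. (cmod (f x - f y))\<^sup>2 / dist x y) / real CARD('a))"
      by (simp only: green[symmetric] inner partial_diff_def case_prod_conv cmod
          of_real_sum of_real_divide of_real_of_nat_eq)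
    thus ?thesis
      by (simp only: nonneg_Reals_of_real_iff) (intro divide_nonneg_nonneg sum_nonneg; simp)
  qed
  with lin green show "\<exists>D :: ('a \<Rightarrow> complex) \<Rightarrow> _. is_laplacian D"
    by (auto simp: is_laplacian_def positive_op_def)
next
  fix D E :: "('a \<Rightarrow> complex) \<Rightarrow> ('a \<Rightarrow> complex)"
  assume "is_laplacian D" "is_laplacian E"
  hence eq: "L2_inner f (D g) = L2_inner f (E g)" for f g
    by (metis is_laplacian_def)
  have "L2_inner (indicator {x}) h = h x / of_nat CARD('a)" for x and h :: "'a \<Rightarrow> complex"
  proof -
    have "cnj (indicator {x} z) * h z = (if z = x then h z else 0)" for z
      by (simp add: indicator_def)
    thus ?thesis
      by (simp add: L2_inner_finite)
  qed
  with eq have "D g x / of_nat CARD('a) = E g x / of_nat CARD('a)" for g x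
    by metis
  hence "D g x = E g x" for g x
    by simp
  thus "D = E" by (intro ext)
qed

lemma is_laplacian_laplacian: "is_laplacian laplacian"
  unfolding laplacian_def by (rule theI'[OF is_laplacian_ex1])


section \<open>The coherent algebra\<close>

text \<open>
  \<open>C(S)\<close> for a compact space \<open>S\<close>: closedness is with respect to the supremum norm,
  i.e. under uniform limits.
\<close>

definition unital_cstar_subalgebra :: "('s::topological_space \<Rightarrow> complex) set \<Rightarrow> bool" where
  "unital_cstar_subalgebra A \<longleftrightarrow>
     A \<subseteq> {f. continuous_on UNIV f} \<and>
     (\<lambda>_. 1) \<in> A \<and>
     (\<forall>f\<in>A. \<forall>g\<in>A. (\<lambda>s. f s + g s) \<in> A) \<and>
     (\<forall>c. \<forall>f\<in>A. (\<lambda>s. c * f s) \<in> A) \<and>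
     (\<forall>f\<in>A. \<forall>g\<in>A. (\<lambda>s. f s * g s) \<in> A) \<and>
     (\<forall>f\<in>A. (\<lambda>s. cnj (f s)) \<in> A) \<and>
     (\<forall>F f. (\<forall>n. F n \<in> A) \<and> uniform_limit UNIV F f sequentially \<longrightarrow> f \<in> A)"

definition conv ::
    "'a measure \<Rightarrow> ('a \<times> 'a \<Rightarrow> complex) \<Rightarrow> ('a \<times> 'a \<Rightarrow> complex) \<Rightarrow> 'a \<times> 'a \<Rightarrow> complex" where
  "conv \<mu> f g = (\<lambda>(x, z). LINT y|\<mu>. f (x, y) * g (y, z))"

definition coherent_subalgebra :: "'a::metric_space measure \<Rightarrow> ('a \<times> 'a \<Rightarrow> complex) set \<Rightarrow> bool" where
  "coherent_subalgebra \<mu> A \<longleftrightarrow>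
     unital_cstar_subalgebra A \<and>
     (\<lambda>(x, y). complex_of_real (dist x y)) \<in> A \<and>
     (\<forall>f\<in>A. \<forall>g\<in>A. conv \<mu> f g \<in> A) \<and>
     (\<forall>f\<in>A. (\<lambda>(x, y). f (y, x)) \<in> A)"

text \<open>Intended for compact \<open>'a\<close> and a faithful Borel probability measure \<open>\<mu>\<close>.\<close>

definition Coh :: "'a::metric_space measure \<Rightarrow> ('a \<times> 'a \<Rightarrow> complex) set" where
  "Coh \<mu> = \<Inter> {A. coherent_subalgebra \<mu> A}"

lemma Coh_least: "coherent_subalgebra \<mu> A \<Longrightarrow> Coh \<mu> \<subseteq> A"
  by (auto simp: Coh_def)

lemma coherent_subalgebra_Coh:
  fixes \<mu> :: "'a::{metric_space,finite} measure"
  shows "coherent_subalgebra \<mu> (Coh \<mu>)"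
proof -
  have top: "coherent_subalgebra \<mu> UNIV"
    by (auto simp: coherent_subalgebra_def unital_cstar_subalgebra_def
        intro: finite_imp_compact continuous_on_finite)
  have mem: "f \<in> Coh \<mu> \<longleftrightarrow> (\<forall>A. coherent_subalgebra \<mu> A \<longrightarrow> f \<in> A)" for f
    by (auto simp: Coh_def)
  show ?thesis
    unfolding coherent_subalgebra_def[of _ "Coh _"] unital_cstar_subalgebra_def[of "Coh _"]
  proof (intro conjI)
    show "Coh \<mu> \<subseteq> {f. continuous_on UNIV f}"
      using Coh_least[OF top] top
      by (auto simp: coherent_subalgebra_def unital_cstar_subalgebra_def)
    show "\<forall>F f. (\<forall>n. F n \<in> Coh \<mu>) \<and> uniform_limit UNIV F f sequentially \<longrightarrow> f \<in> Coh \<mu>"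
    proof (intro allI impI, unfold mem, intro allI impI)
      fix F f A
      assume "(\<forall>n. \<forall>A. coherent_subalgebra \<mu> A \<longrightarrow> F n \<in> A) \<and> uniform_limit UNIV F f sequentially"
        and A: "coherent_subalgebra \<mu> A"
      hence "\<forall>n. F n \<in> A" "uniform_limit UNIV F f sequentially" by auto
      thus "f \<in> A"
        using A unfolding coherent_subalgebra_def unital_cstar_subalgebra_def by metis
    qed
  qed (unfold mem Ball_def, simp_all add: coherent_subalgebra_def unital_cstar_subalgebra_def)
qed

end

(* Since X is finite, d takes finitely many values, so by Lagrange interpolation every function
   of d is a polynomial in d and lies in Coh(X). This applies to c = 1/d (set to 0 on the diagonal)
   and to the indicator \<delta> of the diagonal. As the measure is uniform, |X| (c * 1)(x, z) is the
   degree \<Sum>y. c x y of x, and the Laplacian is 2 |X| (c * 1) \<cdot> \<delta> - 2 c. *)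

theory Submission
  imports Defs
begin

context
  fixes A :: "('s::topological_space \<Rightarrow> complex) set"
  assumes A: "unital_cstar_subalgebra A"
begin

lemma cstar_subalgebra_add: "f \<in> A \<Longrightarrow> g \<in> A \<Longrightarrow> (\<lambda>s. f s + g s) \<in> A"
  and cstar_subalgebra_scale: "f \<in> A \<Longrightarrow> (\<lambda>s. k * f s) \<in> A"
  and cstar_subalgebra_mult: "f \<in> A \<Longrightarrow> g \<in> A \<Longrightarrow> (\<lambda>s. f s * g s) \<in> A"
  and cstar_subalgebra_one: "(\<lambda>_. 1) \<in> A"
  using A by (auto simp: unital_cstar_subalgebra_def)

lemma cstar_subalgebra_const: "(\<lambda>_. k) \<in> A"
  using cstar_subalgebra_scale[OF cstar_subalgebra_one, of k] by simp

lemma cstar_subalgebra_diff: "f \<in> A \<Longrightarrow> g \<in> A \<Longrightarrow> (\<lambda>s. f s - g s) \<in> A"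
  using cstar_subalgebra_add[of f "\<lambda>s. -1 * g s"] cstar_subalgebra_scale[of g "-1"] by simp

lemma cstar_subalgebra_sum:
  assumes "\<And>i. i \<in> I \<Longrightarrow> f i \<in> A"
  shows "(\<lambda>s. \<Sum>i\<in>I. f i s) \<in> A"
  using assms
  by (induction I rule: infinite_finite_induct)
    (auto intro: cstar_subalgebra_const cstar_subalgebra_add)

lemma cstar_subalgebra_prod:
  assumes "\<And>i. i \<in> I \<Longrightarrow> f i \<in> A"
  shows "(\<lambda>s. \<Prod>i\<in>I. f i s) \<in> A"
  using assms
  by (induction I rule: infinite_finite_induct)
    (auto intro: cstar_subalgebra_const cstar_subalgebra_mult)

text \<open>On the finite set \<open>range f\<close> any \<open>\<phi>\<close> agrees with its
  Lagrange interpolation polynomial, and a polynomial in \<open>f\<close> stays in the unital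
  algebra \<open>A\<close>.\<close>

lemma cstar_subalgebra_compose_finite_range:
  assumes f: "f \<in> A" and fin: "finite (range f)"
  shows "(\<lambda>s. \<phi> (f s)) \<in> A"
proof -
  \<comment> \<open>The Lagrange basis polynomial at \<open>a\<close>, evaluated at
    \<open>f s\<close>. Each factor is normalised separately, so it is a scalar multiple of
    \<open>f\<close> minus a constant and equals 1 wherever \<open>f s = a\<close>.\<close>
  let ?L = "\<lambda>a s. \<Prod>b\<in>range f - {a}. inverse (a - b) * (f s - b)"
  have L: "?L a s = (if f s = a then 1 else 0)" if "a \<in> range f" for a s
  proof (cases "f s = a")
    case True
    thus ?thesis by (auto intro!: prod.neutral left_inverse)
  next
    case False
    hence "\<exists>b\<in>range f - {a}. inverse (a - b) * (f s - b) = 0" by auto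
    with fin False show ?thesis by (auto intro!: prod_zero)
  qed
  have "\<phi> (f s) = (\<Sum>a\<in>range f. \<phi> a * ?L a s)" for s
  proof -
    have "(\<Sum>a\<in>range f. \<phi> a * ?L a s) = (\<Sum>a\<in>range f. if f s = a then \<phi> a else 0)"
      by (intro sum.cong refl) (simp add: L)
    thus ?thesis using fin by simp
  qed
  moreover have "(\<lambda>s. \<Sum>a\<in>range f. \<phi> a * ?L a s) \<in> A"
    by (intro cstar_subalgebra_sum cstar_subalgebra_scale cstar_subalgebra_prod
        cstar_subalgebra_diff f cstar_subalgebra_const)
  ultimately show ?thesis by simp
qed

end

text \<open>The entries are read off by testing the defining identity of the Laplacian on point
  indicators; the factor \<open>1 / CARD('a)\<close> occurs on both sides and cancels.\<close>

lemma matrix_laplacian: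
  fixes x y :: "'a::{metric_space,finite}"
  shows "matrix_of_op laplacian (x, y) =
    2 * (if x = y then \<Sum>z\<in>UNIV. complex_of_real (1 / dist x z) else 0) -
    2 * complex_of_real (1 / dist x y)"
proof -
  \<comment> \<open>Since \<open>1 / 0 = 0\<close>, \<open>c\<close> vanishes on the diagonal, so
    the sums over distinct points extend to all of \<open>UNIV\<close>.\<close>
  define c :: "'a \<Rightarrow> 'a \<Rightarrow> complex" where "c u v = complex_of_real (1 / dist u v)" for u v
  have c_sym: "c u v = c v u" for u v
    by (simp add: c_def dist_commute)
  let ?e = "\<lambda>u v. if v = u then 1 else 0 :: complex"
  have e: "indicator {u} = ?e u" for u :: 'a
    by (auto simp: indicator_def)
  have "matrix_of_op laplacian (x, y) / of_nat CARD('a) =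
      L2_inner (?e x) (laplacian (?e y))"
    by (simp add: L2_inner_finite matrix_of_op_def e if_distrib[of cnj] if_distribR
        if_distrib[of "\<lambda>t. t * _"] cong: if_cong)
  also have "\<dots> = C_Z_inner (partial_diff (?e x)) (partial_diff (?e y))"
    using is_laplacian_laplacian by (metis is_laplacian_def)
  also have "\<dots> = (\<Sum>v\<in>UNIV. \<Sum>u\<in>UNIV. (?e x u - ?e x v) * (?e y u - ?e y v) * c u v) / of_nat CARD('a)"
    unfolding C_Z_inner_def integral_uniform_finite c_def partial_diff_def
    by (intro arg_cong2[where f = "(/)"] sum.cong sum.mono_neutral_cong_left) auto
  finally have "matrix_of_op laplacian (x, y) =
      (\<Sum>v\<in>UNIV. \<Sum>u\<in>UNIV. (?e x u - ?e x v) * (?e y u - ?e y v) * c u v)"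
    by simp
  \<comment> \<open>The product is expanded into four Kronecker terms. The two squares give the
    degree when \<open>x = y\<close>; the two cross terms each give \<open>- c x y\<close>.\<close>
  also have "\<dots> = (\<Sum>v\<in>UNIV. \<Sum>u\<in>UNIV.
      (if u = x then if x = y then c x v else 0 else 0) +
      (if v = x then if x = y then c x u else 0 else 0) -
      (if u = x then if v = y then c x y else 0 else 0) -
      (if u = y then if v = x then c x y else 0 else 0))"
    by (intro sum.cong refl) (auto simp: c_sym)
  also have "\<dots> = 2 * (if x = y then \<Sum>z\<in>UNIV. c x z else 0) - 2 * c x y"
  proof -
    \<comment> \<open>Here the condition fixes the outer index, so the sums are swapped before the
      Kronecker term collapses.\<close>
    have "(\<Sum>v\<in>UNIV. \<Sum>u\<in>UNIV. if v = x then h u else 0) = (\<Sum>u\<in>UNIV. h u)"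
      for h :: "'a \<Rightarrow> complex"
      by (subst sum.swap) simp
    thus ?thesis
      by (simp add: sum.distrib sum_subtractf)
  qed
  finally show ?thesis by (simp add: c_def)
qed

theorem proposition3p6:
  shows "matrix_of_op (laplacian :: ('a::{metric_space,finite} \<Rightarrow> complex) \<Rightarrow> 'a \<Rightarrow> complex)
           \<in> Coh (uniform_count_measure (UNIV :: 'a set))"
proof -
  let ?\<mu> = "uniform_count_measure (UNIV :: 'a set)"
  let ?d = "\<lambda>(x :: 'a, y). complex_of_real (dist x y)"
  let ?c = "\<lambda>p. inverse (?d p)"
  \<comment> \<open>Testing \<open>?d p = 0\<close> instead of equality of the coordinates exhibits
    the diagonal indicator as a function of \<open>?d\<close>, ready for interpolation.\<close>
  let ?\<delta> = "\<lambda>p. if ?d p = 0 then 1 else 0 :: complex"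
  have A: "unital_cstar_subalgebra (Coh ?\<mu>)" and d: "?d \<in> Coh ?\<mu>"
    and conv: "\<And>f g. f \<in> Coh ?\<mu> \<Longrightarrow> g \<in> Coh ?\<mu> \<Longrightarrow> conv ?\<mu> f g \<in> Coh ?\<mu>"
    using coherent_subalgebra_Coh[of ?\<mu>] by (auto simp: coherent_subalgebra_def)
  have c: "?c \<in> Coh ?\<mu>" and \<delta>: "?\<delta> \<in> Coh ?\<mu>"
    by (rule cstar_subalgebra_compose_finite_range[OF A d]; simp)+
  \<comment> \<open>The factor \<open>CARD('a)\<close> turns the mean in \<open>conv\<close> back
    into a sum; multiplying by \<open>?\<delta>\<close> confines the degree, constant in the second
    coordinate, to the diagonal.\<close>
  have "matrix_of_op laplacian =
      (\<lambda>p. 2 * of_nat CARD('a) * (conv ?\<mu> ?c (\<lambda>_. 1) p * ?\<delta> p) - 2 * ?c p)"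
    by (rule ext)
      (auto simp: matrix_laplacian conv_def integral_uniform_finite inverse_eq_divide)
  also have "\<dots> \<in> Coh ?\<mu>"
    by (intro cstar_subalgebra_diff[OF A] cstar_subalgebra_scale[OF A] cstar_subalgebra_mult[OF A]
        conv c \<delta> cstar_subalgebra_one[OF A])
  finally show ?thesis .
qed

end
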